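(* Let $T>0$, $a\ge 0$, let $r,s:[0,T]\to\mathbb{R}$ be continuous and let $0<\alpha<\beta<1$. Suppose that there are $m>0$, $R_2>0$ and $R_1\in(0,R_2)$ such that $$m^2<\left(\frac{\pi}{T}\right)^2+\left(\frac a2\right)^2\quad\text{and}\quad f_m(t,x)\ge 0\ \text{ for } t\in[0,T],\ x\in[c_mR_1,R_2],$$ where $f_m(t,x)=r(t)x^\alpha-s(t)x^\beta+m^2x$, and $G_m$, $c_m$ are the Green's function and the constant described in the context. Suppose moreover that: (1) there is a continuous function $g_1:[0,T]\to\mathbb{R}$ such that $f_m(t,x)\le g_1(t)$ for $t\in[0,T]$ and $x\in[c_mR_2,R_2]$, and, with $\delta(t)=\int_0^TG_m(t,\tau)\,g_1(\tau)\,d\tau$ for $t\in[0,T]$, at least one of the following holds: $$\min_{t\in[0,T]}\delta(t)\le c_mR_2\qquad\text{or}\qquad \max_{t\in[0,T]}\delta(t)\le R_2;$$ (2) there is a continuous function $g_0:[0,T]\to\mathbb{R}$ such that $f_m(t,x)\ge g_0(t)\ge 0$ for $t\in[0,T]$ and $x\in[c_mR_1,R_1]$, and, with $\gamma(t)=\int_0^TG_m(t,\tau)\,g_0(\tau)\,d\tau$ for $t\in[0,T]$, at least one of the following holds: $$\min_{t\in[0,T]}\gamma(t)\ge c_mR_1\qquad\text{or}\qquad \max_{t\in[0,T]}\gamma(t)\ge R_1.$$ Then the periodic boundary value problem $$x''(t)+a\,x'(t)=r(t)\,x^{\alpha}(t)-s(t)\,x^{\beta}(t),\quad t\in[0,T],\qquad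 x(0)=x(T),\quad x'(0)=x'(T),$$ has at least one solution $x$ such that $c_mR_1\le x(t)\le R_2$ for all $t\in[0,T]$.
   Context: For $a\ge0$ and $0<m<\sqrt{(\pi/T)^2+(a/2)^2}$, $G_m:[0,T]\times[0,T]\to\mathbb{R}$ denotes the Green's function of the linear periodic problem $x''+a x'+m^2x=h(t)$ on $[0,T]$, $x(0)=x(T)$, $x'(0)=x'(T)$; i.e. for each continuous $h$ on $[0,T]$, the function $x(t)=\int_0^TG_m(t,\tau)h(\tau)\,d\tau$ is the unique solution of this problem. It is known that $G_m$ exists and is unique, that $G_m>0$ on $[0,T]\times[0,T]$, that $\int_0^TG_m(t,\tau)\,d\tau=1/m^2$ for all $t\in[0,T]$, and that there is a constant in $(0,1)$, fixed and denoted $c_m$, such that $G_m(t,\tau)\ge G_m(\tau,\tau)\ge c_m\,G_m(t,\tau)$ for all $(t,\tau)\in[0,T]\times[0,T]$. *)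

theory Defs
  imports "HOL-Analysis.Analysis"
begin

text \<open>Derivatives at 0 and at T are one-sided. Continuity of x'' is not demanded: for
  x'' + a x' = F(t, x) with continuous F it follows from the equation.\<close>

definition periodic_twice_differentiable ::
    "real \<Rightarrow> (real \<Rightarrow> real) \<Rightarrow> (real \<Rightarrow> real) \<Rightarrow> (real \<Rightarrow> real) \<Rightarrow> bool" where
  "periodic_twice_differentiable T x x' x'' \<longleftrightarrow>
     (\<forall>t\<in>{0..T}. (x has_real_derivative x' t) (at t within {0..T})) \<and>
     (\<forall>t\<in>{0..T}. (x' has_real_derivative x'' t) (at t within {0..T})) \<and>
     x 0 = x T \<and> x' 0 = x' T"

definition linear_periodic_solution ::
    "real \<Rightarrow> real \<Rightarrow> real \<Rightarrow> (real \<Rightarrow> real) \<Rightarrow> (real \<Rightarrow> real) \<Rightarrow> bool" where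
  "linear_periodic_solution T a m h x \<longleftrightarrow>
     (\<exists>x' x''. periodic_twice_differentiable T x x' x'' \<and>
        (\<forall>t\<in>{0..T}. x'' t + a * x' t + m\<^sup>2 * x t = h t))"

definition green_integral ::
    "real \<Rightarrow> (real \<Rightarrow> real \<Rightarrow> real) \<Rightarrow> (real \<Rightarrow> real) \<Rightarrow> real \<Rightarrow> real" where
  "green_integral T G h t = integral {0..T} (\<lambda>\<tau>. G t \<tau> * h \<tau>)"

text \<open>Continuity is what makes the Green's function unique pointwise on the square: the
  integral identity alone determines each section G t only almost everywhere. Functions on
  [0,T] are represented by total functions whose values outside [0,T] are irrelevant, so
  uniqueness of solutions is equality on [0,T].\<close>

definition is_periodic_green ::
    "real \<Rightarrow> real \<Rightarrow> real \<Rightarrow> (real \<Rightarrow> real \<Rightarrow> real) \<Rightarrow> bool" where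
  "is_periodic_green T a m G \<longleftrightarrow>
     continuous_on ({0..T} \<times> {0..T}) (\<lambda>(t, \<tau>). G t \<tau>) \<and>
     (\<forall>h. continuous_on {0..T} h \<longrightarrow>
        linear_periodic_solution T a m h (green_integral T G h) \<and>
        (\<forall>y. linear_periodic_solution T a m h y \<longrightarrow>
           (\<forall>t\<in>{0..T}. y t = green_integral T G h t)))"

text \<open>Meaningful only for x > 0, where powr is the usual real power.\<close>

definition f_shift ::
    "(real \<Rightarrow> real) \<Rightarrow> (real \<Rightarrow> real) \<Rightarrow> real \<Rightarrow> real \<Rightarrow> real \<Rightarrow> real \<Rightarrow> real \<Rightarrow> real" where
  "f_shift r s \<alpha> \<beta> m t x = r t * x powr \<alpha> - s t * x powr \<beta> + m\<^sup>2 * x"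

end

theory Submission
  imports Defs "HOL-Complex_Analysis.Great_Picard"
begin

text \<open>
  Adding $m^2 x$ to both sides turns the problem into $x'' + a x' + m^2 x = f_m(t, x)$, so its
  solutions are the fixed points of the Hammerstein operator
  $(Ax)(t) = \int_0^T G_m(t,\tau) f_m(\tau, x(\tau))\,d\tau$. The hypothesis
  $G_m(t,\tau) \ge G_m(\tau,\tau) \ge c\,G_m(t,\tau)$ makes $A$ map functions with
  $f_m(\cdot, x) \ge 0$ into the cone of nonnegative functions with $\min x \ge c \max x$
  (\<open>green_integral_harnack\<close>). The fixed point comes from a compression theorem of
  Krasnoselskii type in that cone (\<open>cone_compression\<close>).

  The outer boundary is $\max x = R_2$. There the cone forces $x \ge c R_2$, so $Ax \le \delta$.
  Both alternatives about $\delta$ give $\max Ax \le R_2$; the one about $\min\delta$ does so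
  because $Ax$ lies in the cone: $c \max Ax \le \min Ax \le c R_2$.

  The inner boundary depends on the alternative about $\gamma$. If $\max\gamma \ge R_1$, it is
  $\max x = R_1$. If $\min\gamma \ge c R_1$, no lower bound on $\max Ax$ better than $c R_1$ follows,
  and the right inner boundary is $\min x = c R_1$. In both cases its points have values in
  $[c R_1, R_1]$, hence $Ax \ge \gamma$ there, and $A$ does not decrease the functional
  $M$ ($\max$ or $\min$) that defines the boundary. The compression theorem is therefore stated
  for a general functional $M$ that is nonexpansive and commutes with adding constants.

  The compression theorem extends $A$ to all continuous functions with values in $[0, R_2]$ in
  such a way that each fixed point of the extension yields one of $A$, and then uses Schauder's
  theorem for such an order interval (\<open>schauder_order_interval\<close>). The latter is
  obtained from Kuhn's combinatorial lemma: interpolation on a fine finite net replaces the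
  operator by a self-map of a cube, whose dimension is a natural number that grows as the net
  is refined; an almost fixed point of that map gives an almost fixed point of the operator; and
  Arzela--Ascoli turns a sequence of these into a fixed point.
\<close>

section \<open>Almost fixed points in cubes\<close>

text \<open>Kuhn's lemma yields a small lattice cell in which, for every coordinate \<open>i\<close>, some corner is
  moved up and another one is moved down in direction \<open>i\<close>. Since neither the points nor their
  images vary much over the cell, every coordinate of its base point is almost fixed. Almost fixed
  points suffice below, so no limit is taken in the cube, and a single pair \<open>d\<close>, \<open>e\<close> is all that
  is needed of the continuity of \<open>f\<close>.\<close>

lemma approx_fixed_point_cube:
  fixes f :: "(nat \<Rightarrow> real) \<Rightarrow> nat \<Rightarrow> real"
  assumes "R > 0" "e > 0" "d > 0"
    and into: "\<And>v i. \<lbrakk>\<forall>j<n. v j \<in> {0..R}; i < n\<rbrakk> \<Longrightarrow> f v i \<in> {0..R}"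
    and uc: "\<And>v w i. \<lbrakk>\<forall>j<n. v j \<in> {0..R}; \<forall>j<n. w j \<in> {0..R}; \<forall>j<n. \<bar>v j - w j\<bar> \<le> d; i < n\<rbrakk>
               \<Longrightarrow> \<bar>f v i - f w i\<bar> \<le> e"
  obtains v where "\<forall>i<n. v i \<in> {0..R}" "\<forall>i<n. \<bar>f v i - v i\<bar> \<le> 2 * e"
proof -
  \<comment> \<open>Within a cell, a mesh below \<open>d\<close> controls the images and one below \<open>e\<close> the points.\<close>
  define h where "h = min d e"
  have "h > 0" using assms by (simp add: h_def)
  obtain p :: nat where p: "R / h < real p"
    using reals_Archimedean2 by blast
  have "real p > 0" using p \<open>R > 0\<close> \<open>h > 0\<close> by (meson divide_pos_pos less_trans)
  then have "p > 0" by simp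
  have mesh: "R / p \<le> h"
    using p \<open>h > 0\<close> \<open>real p > 0\<close> by (simp add: field_simps)
  define P where "P q = (\<lambda>i::nat. R * real (q i) / real p)" for q :: "nat \<Rightarrow> nat"
  have Pbox: "\<forall>j<n. P q j \<in> {0..R}" if "\<forall>i<n. q i \<le> p" for q
    using that \<open>R > 0\<close> \<open>p > 0\<close> by (auto simp: P_def field_simps)
  \<comment> \<open>The label says whether the map moves the coordinate up (0) or down (1). On the upper face, where
    Kuhn's lemma prescribes 1, it cannot move up because its values stay in the cube.\<close>
  define label where
    "label q i = (if q i < p \<and> P q i \<le> f (P q) i then 0 else 1 :: nat)" for q i
  have up: "P q i \<le> f (P q) i" if "label q i = 0" for q i
    using that by (auto simp: label_def split: if_splits)
  have down: "f (P q) i \<le> P q i" if "label q i \<noteq> 0" "\<forall>i<n. q i \<le> p" "i < n" for q i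
  proof (cases "q i < p")
    case True then show ?thesis using that by (auto simp: label_def split: if_splits)
  next
    case False
    then have "P q i = R" using that \<open>p > 0\<close> by (auto simp: P_def)
    then show ?thesis using into[OF Pbox[OF that(2)] that(3)] by simp
  qed
  obtain q where q: "\<forall>i<n. q i < p"
    and rs: "\<forall>i<n. \<exists>r s. (\<forall>j<n. q j \<le> r j \<and> r j \<le> q j + 1) \<and>
        (\<forall>j<n. q j \<le> s j \<and> s j \<le> q j + 1) \<and> label r i \<noteq> label s i"
  proof (rule kuhn_lemma[of p n label])
    show "\<forall>x. (\<forall>i<n. x i \<le> p) \<longrightarrow> (\<forall>i<n. x i = 0 \<longrightarrow> label x i = 0)"
    proof (intro allI impI)
      fix x :: "nat \<Rightarrow> nat" and i
      assume x: "\<forall>i<n. x i \<le> p" and i: "i < n" "x i = 0"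
      then show "label x i = 0"
        using into[OF Pbox[OF x] i(1)] \<open>p > 0\<close> by (simp add: label_def P_def)
    qed
  qed (use \<open>p > 0\<close> in \<open>auto simp: label_def\<close>)
  have near: "\<bar>P q j - P r j\<bar> \<le> h" if "q j \<le> r j" "r j \<le> q j + 1" for r j
  proof -
    have "P r j - P q j = R * (real (r j) - real (q j)) / p"
      by (simp add: P_def diff_divide_distrib right_diff_distrib)
    moreover have "0 \<le> real (r j) - real (q j)" "real (r j) - real (q j) \<le> 1"
      using that by auto
    moreover from this have "R * (real (r j) - real (q j)) / p \<le> R * 1 / p"
      using \<open>R > 0\<close> by (intro divide_right_mono mult_left_mono) auto
    ultimately have "0 \<le> P r j - P q j \<and> P r j - P q j \<le> R / p"
      using \<open>R > 0\<close> by simp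
    then show ?thesis using mesh by linarith
  qed
  have qp: "\<forall>i<n. q i \<le> p" using q by auto
  have "\<bar>f (P q) i - P q i\<bar> \<le> 2 * e" if "i < n" for i
  proof -
    have corner: "\<bar>f (P q) i - f (P r) i\<bar> \<le> e \<and> \<bar>P q i - P r i\<bar> \<le> e \<and> (\<forall>i<n. r i \<le> p)"
      if r: "\<forall>j<n. q j \<le> r j \<and> r j \<le> q j + 1" for r
    proof -
      have rp: "\<forall>i<n. r i \<le> p" using q r by force
      have n: "\<forall>j<n. \<bar>P q j - P r j\<bar> \<le> h" using near r by blast
      then have "\<forall>j<n. \<bar>P q j - P r j\<bar> \<le> d" by (auto simp: h_def)
      then have "\<bar>f (P q) i - f (P r) i\<bar> \<le> e"
        by (rule uc[OF Pbox[OF qp] Pbox[OF rp] _ \<open>i < n\<close>])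
      then show ?thesis using n rp \<open>i < n\<close> by (auto simp: h_def)
    qed
    obtain r s where r: "\<forall>j<n. q j \<le> r j \<and> r j \<le> q j + 1"
      and s: "\<forall>j<n. q j \<le> s j \<and> s j \<le> q j + 1" and "label r i \<noteq> label s i"
      using rs[rule_format, OF \<open>i < n\<close>] by blast
    note rc = corner[OF r] and sc = corner[OF s]
    show ?thesis
    proof (cases "label r i = 0")
      case True
      then have "label s i \<noteq> 0" using \<open>label r i \<noteq> label s i\<close> by simp
      then have "f (P s) i \<le> P s i" using down sc \<open>i < n\<close> by simp
      then show ?thesis using up[OF True] rc sc by linarith
    next
      case False
      then have "label s i = 0"
        using \<open>label r i \<noteq> label s i\<close> by (simp add: label_def split: if_splits)
      moreover have "f (P r) i \<le> P r i" using down[OF False] rc \<open>i < n\<close> by simp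
      ultimately show ?thesis using up[of s i] rc sc by linarith
    qed
  qed
  then show ?thesis by (intro that[OF Pbox[OF qp]]) simp
qed

section \<open>Schauder's theorem for an order interval of continuous functions\<close>

text \<open>Normalised hat functions centred at the points of a finite \<open>\<eta>\<close>-net.\<close>

lemma fine_partition_of_unity:
  fixes S :: "'a::metric_space set"
  assumes "compact S" "\<eta> > 0"
  obtains n :: nat and u :: "nat \<Rightarrow> 'a" and w :: "nat \<Rightarrow> 'a \<Rightarrow> real" where
    "\<And>i. i < n \<Longrightarrow> u i \<in> S"
    "\<And>i. i < n \<Longrightarrow> continuous_on S (w i)"
    "\<And>i t. \<lbrakk>i < n; t \<in> S\<rbrakk> \<Longrightarrow> w i t \<ge> 0"
    "\<And>t. t \<in> S \<Longrightarrow> (\<Sum>i<n. w i t) = 1"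
    "\<And>i t. \<lbrakk>i < n; t \<in> S; w i t \<noteq> 0\<rbrakk> \<Longrightarrow> dist t (u i) < \<eta>"
proof -
  obtain F where F: "F \<subseteq> S" "finite F" "S \<subseteq> (\<Union>x\<in>F. ball x \<eta>)"
  proof (rule compactE_image[OF \<open>compact S\<close>, of S "\<lambda>x. ball x \<eta>"])
    show "S \<subseteq> (\<Union>x\<in>S. ball x \<eta>)" using \<open>\<eta> > 0\<close> by auto
  qed auto
  obtain u where "bij_betw u {0..<card F} F"
    using ex_bij_betw_nat_finite[OF \<open>finite F\<close>] by blast
  then have u: "u ` {..<card F} = F"
    by (simp add: bij_betw_def atLeast0LessThan)
  define n where "n = card F"
  define b where "b i t = max 0 (\<eta> - dist t (u i))" for i t
  define w where "w i t = b i t / (\<Sum>j<n. b j t)" for i t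
  have uS: "u i \<in> S" if "i < n" for i using that u F(1) by (auto simp: n_def)
  have pos: "(\<Sum>j<n. b j t) > 0" if "t \<in> S" for t
  proof -
    have "t \<in> (\<Union>x\<in>F. ball x \<eta>)" using F(3) that by (rule subsetD)
    then obtain x where "x \<in> F" "dist x t < \<eta>" by auto
    moreover from \<open>x \<in> F\<close> obtain i where "i < n" "x = u i" using u by (auto simp: n_def)
    ultimately have "i < n" "dist t (u i) < \<eta>" by (auto simp: dist_commute)
    then show ?thesis
      by (intro sum_pos2[of _ i]) (auto simp: b_def)
  qed
  show ?thesis
  proof (rule that[of n u w])
    show "continuous_on S (w i)" if "i < n" for i
      unfolding w_def b_def
      by (intro continuous_intros) (use pos in \<open>auto simp: b_def less_le\<close>)
    show "w i t \<ge> 0" if "i < n" "t \<in> S" for i t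
      using pos[OF that(2)] by (simp add: w_def b_def)
    show "(\<Sum>i<n. w i t) = 1" if "t \<in> S" for t
      using pos[OF that] by (simp add: w_def flip: sum_divide_distrib)
    show "dist t (u i) < \<eta>" if "i < n" "t \<in> S" "w i t \<noteq> 0" for i t
      using that(3) by (auto simp: w_def b_def max_def split: if_splits)
  qed (use uS in auto)
qed

text \<open>Functions on \<open>S\<close> are represented by total functions, and only their values on \<open>S\<close> count. Applied
  with two representatives of one function, the condition below makes \<open>A\<close> independent of the
  representative, up to equality on \<open>S\<close>.\<close>

definition uniformly_continuous_operator ::
    "'a set \<Rightarrow> ('a \<Rightarrow> real) set \<Rightarrow> (('a \<Rightarrow> real) \<Rightarrow> 'a \<Rightarrow> real) \<Rightarrow> bool" where
  "uniformly_continuous_operator S D A \<longleftrightarrow>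
     (\<forall>e>0. \<exists>d>0. \<forall>x\<in>D. \<forall>y\<in>D.
        (\<forall>t\<in>S. \<bar>x t - y t\<bar> \<le> d) \<longrightarrow> (\<forall>t\<in>S. \<bar>A x t - A y t\<bar> \<le> e))"

definition equicontinuous_image ::
    "'a::metric_space set \<Rightarrow> ('a \<Rightarrow> real) set \<Rightarrow> (('a \<Rightarrow> real) \<Rightarrow> 'a \<Rightarrow> real) \<Rightarrow> bool" where
  "equicontinuous_image S D A \<longleftrightarrow>
     (\<forall>e>0. \<exists>d>0. \<forall>x\<in>D. \<forall>s\<in>S. \<forall>t\<in>S. dist s t < d \<longrightarrow> \<bar>A x s - A x t\<bar> < e)"

definition order_interval :: "'a::topological_space set \<Rightarrow> real \<Rightarrow> ('a \<Rightarrow> real) set" where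
  "order_interval S R = {x. continuous_on S x \<and> (\<forall>t\<in>S. x t \<in> {0..R})}"

lemma weighted_average_dist_le:
  fixes w v :: "nat \<Rightarrow> real"
  assumes "\<And>i. i < n \<Longrightarrow> w i \<ge> 0" "(\<Sum>i<n. w i) = 1"
    and "\<And>i. \<lbrakk>i < n; w i \<noteq> 0\<rbrakk> \<Longrightarrow> \<bar>v i - v' i\<bar> \<le> e"
  shows "\<bar>(\<Sum>i<n. w i * v i) - (\<Sum>i<n. w i * v' i)\<bar> \<le> e"
proof -
  have "\<bar>(\<Sum>i<n. w i * v i) - (\<Sum>i<n. w i * v' i)\<bar> = \<bar>\<Sum>i<n. w i * (v i - v' i)\<bar>"
    by (simp add: sum_subtractf algebra_simps)
  also have "\<dots> \<le> (\<Sum>i<n. \<bar>w i * (v i - v' i)\<bar>)" by (rule sum_abs)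
  also have "\<dots> \<le> (\<Sum>i<n. w i * e)"
  proof (rule sum_mono)
    fix i assume "i \<in> {..<n}"
    then show "\<bar>w i * (v i - v' i)\<bar> \<le> w i * e"
      using assms by (cases "w i = 0") (auto simp: abs_mult mult_left_mono)
  qed
  also have "\<dots> = e" using assms(2) by (simp flip: sum_distrib_right)
  finally show ?thesis .
qed

text \<open>With a partition of unity \<open>w\<close> subordinate to small balls around the nodes \<open>u\<close>, a vector \<open>v\<close> of
  node values is interpolated by \<open>E v = (\<Sum>i<n. w i * v i)\<close>, which does not increase sup-norm
  distances. The map that sends \<open>v\<close> to the node values of \<open>B (E v)\<close> acts on a cube and has an almost
  fixed point \<open>v\<close>. By equicontinuity interpolation changes \<open>B (E v)\<close> only little, so \<open>E v\<close> is almost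
  fixed by \<open>B\<close>.\<close>

lemma approx_fixed_point_order_interval:
  fixes S :: "'a::metric_space set"
  assumes "compact S" "R > 0" "e > 0"
    and into: "\<And>x. x \<in> order_interval S R \<Longrightarrow> B x \<in> order_interval S R"
    and uc: "uniformly_continuous_operator S (order_interval S R) B"
    and eq: "equicontinuous_image S (order_interval S R) B"
  obtains x where "x \<in> order_interval S R" "\<forall>t\<in>S. \<bar>B x t - x t\<bar> \<le> 3 * e"
proof -
  let ?D = "order_interval S R"
  obtain \<eta> where "\<eta> > 0" and \<eta>: "\<And>x s t. \<lbrakk>x \<in> ?D; s \<in> S; t \<in> S; dist s t < \<eta>\<rbrakk> \<Longrightarrow> \<bar>B x s - B x t\<bar> < e"
    using eq \<open>e > 0\<close> unfolding equicontinuous_image_def by metis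
  obtain d where "d > 0" and d: "\<And>x y t. \<lbrakk>x \<in> ?D; y \<in> ?D; \<forall>t\<in>S. \<bar>x t - y t\<bar> \<le> d; t \<in> S\<rbrakk>
      \<Longrightarrow> \<bar>B x t - B y t\<bar> \<le> e"
    using uc \<open>e > 0\<close> unfolding uniformly_continuous_operator_def by metis
  obtain n :: nat and u w where uS: "\<And>i. i < n \<Longrightarrow> u i \<in> S"
    and wc: "\<And>i. i < n \<Longrightarrow> continuous_on S (w i)"
    and w0: "\<And>i t. \<lbrakk>i < n; t \<in> S\<rbrakk> \<Longrightarrow> w i t \<ge> (0::real)"
    and w1: "\<And>t. t \<in> S \<Longrightarrow> (\<Sum>i<n. w i t) = 1"
    and supp: "\<And>i t. \<lbrakk>i < n; t \<in> S; w i t \<noteq> 0\<rbrakk> \<Longrightarrow> dist t (u i) < \<eta>"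
    using fine_partition_of_unity[OF \<open>compact S\<close> \<open>\<eta> > 0\<close>] by blast
  define E where "E v = (\<lambda>t. \<Sum>i<n. w i t * v i)" for v
  have ED: "E v \<in> ?D" if v: "\<forall>j<n. v j \<in> {0..R}" for v
  proof -
    have "E v t \<in> {0..R}" if "t \<in> S" for t
    proof -
      have "0 \<le> E v t" unfolding E_def using v w0 that by (intro sum_nonneg) auto
      moreover have "E v t \<le> (\<Sum>i<n. w i t * R)"
        unfolding E_def using v w0 that by (intro sum_mono mult_left_mono) auto
      ultimately show ?thesis using w1[OF that] by (simp flip: sum_distrib_right)
    qed
    moreover have "continuous_on S (E v)"
      unfolding E_def by (intro continuous_intros wc) auto
    ultimately show ?thesis by (simp add: order_interval_def)
  qed
  obtain v where v: "\<forall>i<n. v i \<in> {0..R}" "\<forall>i<n. \<bar>B (E v) (u i) - v i\<bar> \<le> 2 * e"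
  proof (rule approx_fixed_point_cube[of R e d n "\<lambda>v i. B (E v) (u i)"])
    show "B (E v) (u i) \<in> {0..R}" if "\<forall>j<n. v j \<in> {0..R}" "i < n" for v i
      using into[OF ED[OF that(1)]] uS[OF that(2)] by (auto simp: order_interval_def)
    show "\<bar>B (E v) (u i) - B (E v') (u i)\<bar> \<le> e"
      if "\<forall>j<n. v j \<in> {0..R}" "\<forall>j<n. v' j \<in> {0..R}" "\<forall>j<n. \<bar>v j - v' j\<bar> \<le> d" "i < n" for v v' i
    proof (rule d[OF ED ED _ uS])
      show "\<forall>t\<in>S. \<bar>E v t - E v' t\<bar> \<le> d"
        unfolding E_def using that by (intro ballI weighted_average_dist_le w0 w1) auto
    qed (use that in auto)
  qed (use assms \<open>d > 0\<close> in auto)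
  have "\<bar>B (E v) t - E v t\<bar> \<le> 3 * e" if "t \<in> S" for t
  proof -
    have "\<bar>(\<Sum>i<n. w i t * B (E v) t) - (\<Sum>i<n. w i t * v i)\<bar> \<le> 3 * e"
    proof (rule weighted_average_dist_le[OF w0 w1])
      fix i assume i: "i < n" "w i t \<noteq> 0"
      then have "\<bar>B (E v) t - B (E v) (u i)\<bar> < e"
        using \<eta>[OF ED[OF v(1)] \<open>t \<in> S\<close> uS supp] that by blast
      then show "\<bar>B (E v) t - v i\<bar> \<le> 3 * e" using v(2) i(1) by force
    qed (use that in auto)
    then show ?thesis using w1[OF that] by (simp add: E_def flip: sum_distrib_right)
  qed
  then show ?thesis using that ED[OF v(1)] by blast
qed

text \<open>Almost fixed points \<open>X k\<close> are close to their images, and the images have a uniformly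
  convergent subsequence by Arzela--Ascoli; so both converge to the same limit, which is a fixed point
  by continuity.\<close>

lemma schauder_order_interval:
  fixes S :: "'a::euclidean_space set"
  assumes "compact S" "R > 0"
    and into: "\<And>x. x \<in> order_interval S R \<Longrightarrow> B x \<in> order_interval S R"
    and uc: "uniformly_continuous_operator S (order_interval S R) B"
    and eq: "equicontinuous_image S (order_interval S R) B"
  obtains x where "x \<in> order_interval S R" "\<forall>t\<in>S. B x t = x t"
proof -
  let ?D = "order_interval S R"
  have "\<exists>x. x \<in> ?D \<and> (\<forall>t\<in>S. \<bar>B x t - x t\<bar> \<le> 3 * (1 / Suc k))" for k
    by (rule approx_fixed_point_order_interval[of S R "1 / Suc k" B]) (use assms in auto)
  then obtain X where X: "\<And>k. X k \<in> ?D" "\<And>k t. t \<in> S \<Longrightarrow> \<bar>B (X k) t - X k t\<bar> \<le> 3 * (1 / Suc k)"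
    by metis
  have BX: "B (X k) \<in> ?D" for k using into X(1) .
  obtain g k where g: "continuous_on S g" and "strict_mono (k :: nat \<Rightarrow> nat)"
    and lim: "\<And>e. 0 < e \<Longrightarrow> \<exists>N. \<forall>n x. n \<ge> N \<and> x \<in> S \<longrightarrow> norm (B (X (k n)) x - g x) < e"
  proof (rule Arzela_Ascoli[of S "\<lambda>n. B (X n)" R])
    show "norm (B (X n) x) \<le> R" if "x \<in> S" for n x
      using BX[of n] that by (auto simp: order_interval_def)
    show "\<exists>d>0. \<forall>n y. y \<in> S \<and> norm (x - y) < d \<longrightarrow> norm (B (X n) x - B (X n) y) < e"
      if "x \<in> S" "0 < e" for x e
      using eq that X(1) unfolding equicontinuous_image_def by (simp add: dist_norm) meson
  qed (use assms in auto)
  have close: "\<exists>n. \<forall>t\<in>S. \<bar>B (X n) t - g t\<bar> < e \<and> \<bar>X n t - g t\<bar> < 2 * e" if "e > 0" for e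
  proof -
    obtain N where N: "\<And>n x. \<lbrakk>n \<ge> N; x \<in> S\<rbrakk> \<Longrightarrow> norm (B (X (k n)) x - g x) < e"
      using lim \<open>e > 0\<close> by meson
    obtain M :: nat where M: "3 / e < real M" using reals_Archimedean2 by blast
    define n where "n = k (max N M)"
    have "M \<le> n"
      unfolding n_def using seq_suble[OF \<open>strict_mono k\<close>, of "max N M"] by simp
    then have "3 / e < real (Suc n)" using M by linarith
    then have small: "3 * (1 / Suc n) < e" using \<open>e > 0\<close> by (simp add: field_simps)
    have "\<bar>B (X n) t - g t\<bar> < e \<and> \<bar>X n t - g t\<bar> < 2 * e" if "t \<in> S" for t
    proof -
      have "\<bar>B (X n) t - g t\<bar> < e" using N[of "max N M" t] that by (simp add: n_def)
      then show ?thesis using X(2)[OF that, of n] small by linarith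
    qed
    then show ?thesis by blast
  qed
  have "g t \<in> {0..R}" if "t \<in> S" for t
  proof -
    have "0 \<le> g t + e \<and> g t \<le> R + e" if "e > 0" for e
    proof -
      obtain n where "\<bar>B (X n) t - g t\<bar> < e" using close[OF \<open>e > 0\<close>] \<open>t \<in> S\<close> by blast
      then show ?thesis using BX[of n] \<open>t \<in> S\<close> by (force simp: order_interval_def)
    qed
    then have "g t \<le> R" "0 \<le> g t"
      by (blast intro: field_le_epsilon)+
    then show ?thesis by simp
  qed
  then have gD: "g \<in> ?D" using g by (simp add: order_interval_def)
  have small: "\<bar>B g t - g t\<bar> \<le> e" if "t \<in> S" "e > 0" for t e
  proof -
    obtain d where "d > 0" and d: "\<And>x y t. \<lbrakk>x \<in> ?D; y \<in> ?D; \<forall>t\<in>S. \<bar>x t - y t\<bar> \<le> d; t \<in> S\<rbrakk>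
        \<Longrightarrow> \<bar>B x t - B y t\<bar> \<le> e / 2"
      using uc half_gt_zero[OF \<open>e > 0\<close>] unfolding uniformly_continuous_operator_def by metis
    obtain n where n: "\<forall>t\<in>S. \<bar>B (X n) t - g t\<bar> < min (d/2) (e/2) \<and> \<bar>X n t - g t\<bar> < 2 * min (d/2) (e/2)"
      using close[of "min (d/2) (e/2)"] \<open>d > 0\<close> \<open>e > 0\<close> by auto
    have "\<forall>t\<in>S. \<bar>X n t - g t\<bar> \<le> d" using n by force
    then have "\<bar>B (X n) t - B g t\<bar> \<le> e / 2" using d X(1) gD \<open>t \<in> S\<close> by blast
    moreover have "\<bar>B (X n) t - g t\<bar> < e / 2" using n \<open>t \<in> S\<close> by auto
    ultimately show ?thesis by linarith
  qed
  have "\<bar>B g t - g t\<bar> \<le> 0" if "t \<in> S" for t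
    by (rule field_le_epsilon) (use small that in simp)
  then have "\<forall>t\<in>S. B g t = g t" by force
  then show ?thesis using that gD by blast
qed

section \<open>Maximum and minimum as functionals on continuous functions\<close>

lemma SUP_attained:
  fixes x :: "'a::topological_space \<Rightarrow> real"
  assumes "compact S" "S \<noteq> {}" "continuous_on S x"
  obtains s where "s \<in> S" "(SUP t\<in>S. x t) = x s" "\<forall>t\<in>S. x t \<le> x s"
proof -
  obtain s where "s \<in> S" "\<forall>t\<in>S. x t \<le> x s"
    using continuous_attains_sup[OF assms] by blast
  then show ?thesis using that cSup_eq_maximum[of "x s" "x ` S"] by blast
qed

lemma INF_attained:
  fixes x :: "'a::topological_space \<Rightarrow> real"
  assumes "compact S" "S \<noteq> {}" "continuous_on S x"
  obtains s where "s \<in> S" "(INF t\<in>S. x t) = x s" "\<forall>t\<in>S. x s \<le> x t"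
proof -
  obtain s where "s \<in> S" "\<forall>t\<in>S. x s \<le> x t"
    using continuous_attains_inf[OF assms] by blast
  then show ?thesis using that cInf_eq_minimum[of "x s" "x ` S"] by blast
qed

lemma SUP_nonexpansive:
  fixes x y :: "'a::topological_space \<Rightarrow> real"
  assumes "compact S" "S \<noteq> {}" "continuous_on S x" "continuous_on S y"
    and "\<forall>t\<in>S. \<bar>x t - y t\<bar> \<le> d"
  shows "\<bar>(SUP t\<in>S. x t) - (SUP t\<in>S. y t)\<bar> \<le> d"
proof -
  obtain s where s: "s \<in> S" "(SUP t\<in>S. x t) = x s" "\<forall>t\<in>S. x t \<le> x s"
    using SUP_attained assms by blast
  obtain r where r: "r \<in> S" "(SUP t\<in>S. y t) = y r" "\<forall>t\<in>S. y t \<le> y r"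
    using SUP_attained assms by blast
  show ?thesis using s r assms(5) by (smt (verit))
qed

lemma INF_nonexpansive:
  fixes x y :: "'a::topological_space \<Rightarrow> real"
  assumes "compact S" "S \<noteq> {}" "continuous_on S x" "continuous_on S y"
    and "\<forall>t\<in>S. \<bar>x t - y t\<bar> \<le> d"
  shows "\<bar>(INF t\<in>S. x t) - (INF t\<in>S. y t)\<bar> \<le> d"
proof -
  obtain s where s: "s \<in> S" "(INF t\<in>S. x t) = x s" "\<forall>t\<in>S. x s \<le> x t"
    using INF_attained assms by blast
  obtain r where r: "r \<in> S" "(INF t\<in>S. y t) = y r" "\<forall>t\<in>S. y r \<le> y t"
    using INF_attained assms by blast
  show ?thesis using s r assms(5) by (smt (verit))
qed

lemma SUP_translate:
  fixes x :: "'a::topological_space \<Rightarrow> real"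
  assumes "compact S" "S \<noteq> {}" "continuous_on S x"
  shows "(SUP t\<in>S. x t + k) = (SUP t\<in>S. x t) + k"
proof -
  obtain s where "s \<in> S" "(SUP t\<in>S. x t) = x s" "\<forall>t\<in>S. x t \<le> x s"
    using SUP_attained assms by blast
  then show ?thesis by (auto intro: cSup_eq_maximum)
qed

lemma INF_translate:
  fixes x :: "'a::topological_space \<Rightarrow> real"
  assumes "compact S" "S \<noteq> {}" "continuous_on S x"
  shows "(INF t\<in>S. x t + k) = (INF t\<in>S. x t) + k"
proof -
  obtain s where "s \<in> S" "(INF t\<in>S. x t) = x s" "\<forall>t\<in>S. x s \<le> x t"
    using INF_attained assms by blast
  then show ?thesis by (auto intro: cInf_eq_minimum)
qed

section \<open>A compression theorem in the Harnack cone\<close>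

text \<open>The last condition is $\min x \ge c \max x$; for pairs of points it can be checked under the
  integral sign, without extrema.\<close>

definition harnack_cone :: "'a::topological_space set \<Rightarrow> real \<Rightarrow> ('a \<Rightarrow> real) set" where
  "harnack_cone S c =
     {x. continuous_on S x \<and> (\<forall>t\<in>S. 0 \<le> x t) \<and> (\<forall>s\<in>S. \<forall>t\<in>S. c * x s \<le> x t)}"

definition cone_section ::
    "'a::topological_space set \<Rightarrow> real \<Rightarrow> real \<Rightarrow> real \<Rightarrow> ('a \<Rightarrow> real) set" where
  "cone_section S c l R = {x \<in> harnack_cone S c. \<forall>t\<in>S. l \<le> x t \<and> x t \<le> R}"

lemma harnack_cone_add_const:
  assumes "x \<in> harnack_cone S c" "c \<le> 1" "k \<ge> 0"
  shows "(\<lambda>t. x t + k) \<in> harnack_cone S c"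
proof -
  have "c * k \<le> k" using assms mult_right_mono[of c 1 k] by simp
  then show ?thesis using assms
    by (auto simp: harnack_cone_def distrib_left intro!: continuous_intros add_mono)
qed

lemma harnack_cone_min_const:
  assumes "x \<in> harnack_cone S c" "0 \<le> c" "c \<le> 1" "R \<ge> 0"
  shows "(\<lambda>t. min R (x t)) \<in> harnack_cone S c"
proof -
  have "c * min R (x s) \<le> min R (x t)" if "s \<in> S" "t \<in> S" for s t
  proof -
    have "c * min R (x s) \<le> c * R" "c * min R (x s) \<le> c * x s"
      using \<open>0 \<le> c\<close> by (auto intro!: mult_left_mono)
    moreover have "c * R \<le> R" using assms mult_right_mono[of c 1 R] by simp
    moreover have "c * x s \<le> x t" using assms(1) that by (simp add: harnack_cone_def)
    ultimately show ?thesis by simp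
  qed
  then show ?thesis using assms
    by (auto simp: harnack_cone_def intro!: continuous_intros)
qed

text \<open>Raising a function to at least $c$ times its maximum is, for $0 \le c \le 1$, a nonexpansive
  retraction of the nonnegative continuous functions on a compact set onto the cone.\<close>

definition cone_retraction :: "'a set \<Rightarrow> real \<Rightarrow> ('a \<Rightarrow> real) \<Rightarrow> 'a \<Rightarrow> real" where
  "cone_retraction S c x = (\<lambda>t. max (x t) (c * (SUP s\<in>S. x s)))"

lemma cone_retraction_in_cone:
  assumes "compact S" "S \<noteq> {}" "0 \<le> c" "c \<le> 1" "x \<in> order_interval S R"
  shows "cone_retraction S c x \<in> harnack_cone S c"
    and "t \<in> S \<Longrightarrow> cone_retraction S c x t \<le> R"
proof -
  have x: "continuous_on S x" "\<forall>t\<in>S. 0 \<le> x t \<and> x t \<le> R"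
    using assms by (auto simp: order_interval_def)
  obtain s where s: "s \<in> S" "(SUP t\<in>S. x t) = x s" "\<forall>t\<in>S. x t \<le> x s"
    using SUP_attained assms(1,2) x(1) by blast
  have cs: "0 \<le> c * x s" "c * x s \<le> x s" using assms s x by (auto simp: mult_left_le_one_le)
  have "cone_retraction S c x r \<le> x s" if "r \<in> S" for r
    using s cs that by (simp add: cone_retraction_def)
  then have "c * cone_retraction S c x r \<le> c * x s" if "r \<in> S" for r
    using that \<open>0 \<le> c\<close> by (intro mult_left_mono)
  moreover have "c * x s \<le> cone_retraction S c x t" for t
    using s(2) by (simp add: cone_retraction_def)
  ultimately have "c * cone_retraction S c x r \<le> cone_retraction S c x t" if "r \<in> S" for r t
    using that order_trans by blast
  then show "cone_retraction S c x \<in> harnack_cone S c"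
    using cs s x(1)
    by (auto simp: harnack_cone_def cone_retraction_def intro!: continuous_intros)
  show "cone_retraction S c x t \<le> R" if "t \<in> S"
    using s x cs that by (force simp: cone_retraction_def)
qed

lemma cone_retraction_id:
  assumes "compact S" "S \<noteq> {}" "x \<in> harnack_cone S c" "t \<in> S"
  shows "cone_retraction S c x t = x t"
proof -
  have x: "continuous_on S x" "\<forall>s\<in>S. \<forall>t\<in>S. c * x s \<le> x t"
    using assms by (auto simp: harnack_cone_def)
  obtain s where "s \<in> S" "(SUP t\<in>S. x t) = x s"
    using SUP_attained assms(1,2) x(1) by blast
  then show ?thesis using x assms by (simp add: cone_retraction_def max_def order_antisym)
qed

lemma cone_retraction_nonexpansive:
  assumes "compact S" "S \<noteq> {}" "0 \<le> c" "c \<le> 1" "continuous_on S x" "continuous_on S y"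
    and "\<forall>t\<in>S. \<bar>x t - y t\<bar> \<le> d" "t \<in> S"
  shows "\<bar>cone_retraction S c x t - cone_retraction S c y t\<bar> \<le> d"
proof -
  let ?X = "SUP s\<in>S. x s" and ?Y = "SUP s\<in>S. y s"
  have "\<bar>c * ?X - c * ?Y\<bar> = c * \<bar>?X - ?Y\<bar>"
    using assms by (simp add: abs_mult flip: right_diff_distrib)
  also have "\<dots> \<le> \<bar>?X - ?Y\<bar>" using assms by (simp add: mult_left_le_one_le)
  also have "\<dots> \<le> d" by (rule SUP_nonexpansive) (use assms in auto)
  finally have "\<bar>c * ?X - c * ?Y\<bar> \<le> d" .
  moreover have "\<bar>x t - y t\<bar> \<le> d" using assms by blast
  ultimately show ?thesis unfolding cone_retraction_def by (simp add: max_def abs_le_iff)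
qed

text \<open>The sets $M x = L$ and $\max x = R$ are the inner and the outer boundary of the region. \<open>A\<close> is
  controlled only between them, and is extended to the whole order interval as follows. A function \<open>x\<close> is
  first retracted to the cone; if it then lies below the inner boundary, it is lifted onto it by
  adding a constant \<open>\<mu> x\<close>; and \<open>B x\<close> is \<open>A\<close> of the result plus the same constant, cut off at \<open>R\<close>.

  A fixed point \<open>x\<close> of \<open>B\<close> lies in the cone. Suppose it lies below the inner boundary. Then it stays
  below \<open>R\<close>, the cut-off is inactive, and $M x = M (A y) + \mu \ge L + \mu > L$ for the lifted
  function \<open>y\<close>, which is impossible. So nothing was added. If the cut-off were active at a point,
  \<open>x\<close> would attain \<open>R\<close> there, and the outer condition excludes values of \<open>A x\<close> above \<open>R\<close>.\<close>

theorem cone_compression: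
  fixes S :: "'a::euclidean_space set" and M :: "('a \<Rightarrow> real) \<Rightarrow> real"
  assumes S: "compact S" "S \<noteq> {}" and c: "0 \<le> c" "c \<le> 1" and "R > 0"
    and M_nonexp: "\<And>x y d. \<lbrakk>continuous_on S x; continuous_on S y; \<forall>t\<in>S. \<bar>x t - y t\<bar> \<le> d\<rbrakk>
                    \<Longrightarrow> \<bar>M x - M y\<bar> \<le> d"
    and M_transl: "\<And>x k. continuous_on S x \<Longrightarrow> M (\<lambda>t. x t + k) = M x + k"
    and lower: "\<And>x t. \<lbrakk>x \<in> harnack_cone S c; M x \<ge> L; t \<in> S\<rbrakk> \<Longrightarrow> l \<le> x t"
    and upper: "\<And>x t. \<lbrakk>x \<in> harnack_cone S c; M x \<le> L; t \<in> S\<rbrakk> \<Longrightarrow> x t < R"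
    and into: "\<And>x. x \<in> cone_section S c l R \<Longrightarrow> A x \<in> harnack_cone S c"
    and uc: "uniformly_continuous_operator S (cone_section S c l R) A"
    and eq: "equicontinuous_image S (cone_section S c l R) A"
    and inner: "\<And>x. \<lbrakk>x \<in> cone_section S c l R; M x = L\<rbrakk> \<Longrightarrow> M (A x) \<ge> L"
    and outer: "\<And>x s t. \<lbrakk>x \<in> cone_section S c l R; s \<in> S; x s = R; t \<in> S\<rbrakk> \<Longrightarrow> A x t \<le> R"
  obtains x where "x \<in> cone_section S c l R" "\<forall>t\<in>S. A x t = x t"
proof -
  let ?D = "order_interval S R" and ?K = "cone_section S c l R"
  define \<kappa> where "\<kappa> = cone_retraction S c"
  define \<mu> where "\<mu> x = max 0 (L - M (\<kappa> x))" for x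
  define lift where "lift x = (\<lambda>t. \<kappa> x t + \<mu> x)" for x
  define B where "B x = (\<lambda>t. min R (A (lift x) t + \<mu> x))" for x
  have cone_cont: "continuous_on S x" if "x \<in> harnack_cone S c" for x
    using that by (simp add: harnack_cone_def)
  have \<kappa>_cone: "\<kappa> x \<in> harnack_cone S c" if "x \<in> ?D" for x
    unfolding \<kappa>_def by (rule cone_retraction_in_cone[OF S c that])
  have lift_K: "lift x \<in> ?K" if "x \<in> ?D" for x
  proof -
    have l: "lift x \<in> harnack_cone S c"
      unfolding lift_def by (intro harnack_cone_add_const \<kappa>_cone that c) (simp add: \<mu>_def)
    \<comment> \<open>Hence \<open>M (lift x) = max L (M (\<kappa> x))\<close>.\<close>
    have Ml: "M (lift x) = M (\<kappa> x) + \<mu> x"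
      unfolding lift_def by (intro M_transl cone_cont \<kappa>_cone that)
    have "lift x t \<le> R" if "t \<in> S" for t
    proof (cases "M (\<kappa> x) \<ge> L")
      case True
      then show ?thesis
        using cone_retraction_in_cone(2)[OF S c \<open>x \<in> ?D\<close> that] by (simp add: lift_def \<mu>_def \<kappa>_def)
    next
      case False
      then have "M (lift x) \<le> L" using Ml by (simp add: \<mu>_def)
      then show ?thesis using upper[OF l _ that] by simp
    qed
    moreover have "M (lift x) \<ge> L" using Ml by (simp add: \<mu>_def)
    ultimately show ?thesis using l lower by (simp add: cone_section_def)
  qed
  have B_cone: "B x \<in> harnack_cone S c" if "x \<in> ?D" for x
    unfolding B_def using \<open>R > 0\<close> c
    by (intro harnack_cone_min_const harnack_cone_add_const into lift_K that) (auto simp: \<mu>_def)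
  then have B_D: "B x \<in> ?D" if "x \<in> ?D" for x
    using that by (auto simp: harnack_cone_def order_interval_def B_def)
  have D_cont: "continuous_on S x" if "x \<in> ?D" for x
    using that by (simp add: order_interval_def)
  have "uniformly_continuous_operator S ?D B"
    unfolding uniformly_continuous_operator_def
  proof (intro allI impI)
    fix e :: real assume "e > 0"
    then obtain d where "d > 0" and d: "\<And>x y t. \<lbrakk>x \<in> ?K; y \<in> ?K; \<forall>t\<in>S. \<bar>x t - y t\<bar> \<le> d; t \<in> S\<rbrakk>
        \<Longrightarrow> \<bar>A x t - A y t\<bar> \<le> e / 2"
      using uc half_gt_zero[OF \<open>e > 0\<close>] unfolding uniformly_continuous_operator_def by metis
    define d' where "d' = min (d / 2) (e / 2)"
    have "\<bar>B x t - B y t\<bar> \<le> e"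
      if "x \<in> ?D" "y \<in> ?D" and xy: "\<forall>t\<in>S. \<bar>x t - y t\<bar> \<le> d'" and "t \<in> S" for x y t
    proof -
      have \<kappa>: "\<forall>t\<in>S. \<bar>\<kappa> x t - \<kappa> y t\<bar> \<le> d'"
        unfolding \<kappa>_def using cone_retraction_nonexpansive[OF S c _ _ xy] D_cont that by blast
      then have "\<bar>M (\<kappa> x) - M (\<kappa> y)\<bar> \<le> d'"
        by (intro M_nonexp cone_cont \<kappa>_cone that)
      then have \<mu>: "\<bar>\<mu> x - \<mu> y\<bar> \<le> d'" unfolding \<mu>_def by linarith
      have "\<bar>lift x s - lift y s\<bar> \<le> d" if "s \<in> S" for s
      proof -
        have "\<bar>\<kappa> x s - \<kappa> y s\<bar> \<le> d / 2" "\<bar>\<mu> x - \<mu> y\<bar> \<le> d / 2"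
          using \<kappa> \<mu> that by (auto simp: d'_def)
        then show ?thesis unfolding lift_def by linarith
      qed
      then have "\<bar>A (lift x) t - A (lift y) t\<bar> \<le> e / 2"
        by (intro d lift_K that ballI)
      moreover have "\<bar>\<mu> x - \<mu> y\<bar> \<le> e / 2" using \<mu> by (simp add: d'_def)
      ultimately show ?thesis unfolding B_def by linarith
    qed
    moreover have "d' > 0" using \<open>d > 0\<close> \<open>e > 0\<close> by (simp add: d'_def)
    ultimately show "\<exists>d>0. \<forall>x\<in>?D. \<forall>y\<in>?D. (\<forall>t\<in>S. \<bar>x t - y t\<bar> \<le> d) \<longrightarrow> (\<forall>t\<in>S. \<bar>B x t - B y t\<bar> \<le> e)"
      by blast
  qed
  moreover have "equicontinuous_image S ?D B"
    unfolding equicontinuous_image_def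
  proof (intro allI impI)
    fix e :: real assume "e > 0"
    then obtain d where "d > 0"
      and d: "\<And>x s t. \<lbrakk>x \<in> ?K; s \<in> S; t \<in> S; dist s t < d\<rbrakk> \<Longrightarrow> \<bar>A x s - A x t\<bar> < e"
      using eq unfolding equicontinuous_image_def by metis
    have "\<bar>B x s - B x t\<bar> < e" if "x \<in> ?D" "s \<in> S" "t \<in> S" "dist s t < d" for x s t
      using d[OF lift_K[OF that(1)] that(2-)] \<open>e > 0\<close> unfolding B_def by linarith
    then show "\<exists>d>0. \<forall>x\<in>?D. \<forall>s\<in>S. \<forall>t\<in>S. dist s t < d \<longrightarrow> \<bar>B x s - B x t\<bar> < e"
      using \<open>d > 0\<close> by blast
  qed
  ultimately obtain x where x: "x \<in> ?D" and fixed: "\<forall>t\<in>S. B x t = x t"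
    using schauder_order_interval[of S R B] S(1) \<open>R > 0\<close> B_D by blast
  define y where "y = lift x"
  have y: "y \<in> ?K" unfolding y_def by (rule lift_K[OF x])
  have x_cone: "x \<in> harnack_cone S c"
  proof -
    have "continuous_on S x" using D_cont x .
    then show ?thesis using B_cone[OF x] fixed by (simp add: harnack_cone_def)
  qed
  have \<kappa>x: "\<forall>t\<in>S. \<kappa> x t = x t"
    unfolding \<kappa>_def using cone_retraction_id[OF S x_cone] by blast
  then have M\<kappa>: "M (\<kappa> x) = M x"
    using M_nonexp[of "\<kappa> x" x 0] cone_cont \<kappa>_cone x x_cone by force
  have xy: "x t = min R (A y t + \<mu> x)" if "t \<in> S" for t
    using fixed that by (simp add: B_def y_def)
  \<comment> \<open>The inner condition excludes fixed points below the inner boundary.\<close>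
  have "\<mu> x = 0"
  proof (rule ccontr)
    assume "\<mu> x \<noteq> 0"
    then have less: "M x < L" and \<mu>: "\<mu> x = L - M x" by (auto simp: \<mu>_def M\<kappa> max_def split: if_splits)
    have "M y = M (\<kappa> x) + \<mu> x"
      unfolding y_def lift_def by (intro M_transl cone_cont \<kappa>_cone x)
    then have "M (A y) \<ge> L" using inner[OF y] \<mu> M\<kappa> by simp
    have "\<forall>t\<in>S. \<bar>x t - (A y t + \<mu> x)\<bar> \<le> 0"
    proof
      fix t assume "t \<in> S"
      then show "\<bar>x t - (A y t + \<mu> x)\<bar> \<le> 0"
        using upper[OF x_cone _ \<open>t \<in> S\<close>] less xy[OF \<open>t \<in> S\<close>] by linarith
    qed
    then have "\<bar>M x - M (\<lambda>t. A y t + \<mu> x)\<bar> \<le> 0"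
      by (intro M_nonexp cone_cont x_cone into y harnack_cone_add_const c) (simp add: \<mu>_def)
    then have "M x = M (A y) + \<mu> x"
      using M_transl[OF cone_cont[OF into[OF y]]] by simp
    then show False using \<open>M (A y) \<ge> L\<close> \<mu> less by simp
  qed
  then have yx: "\<forall>t\<in>S. y t = x t" using \<kappa>x by (simp add: y_def lift_def)
  have "A y t = y t" if "t \<in> S" for t
  proof (rule ccontr)
    assume "A y t \<noteq> y t"
    then have "y t = R" "A y t > R"
      using xy[OF that] yx that \<open>\<mu> x = 0\<close> by (auto simp: min_def split: if_splits)
    then show False using outer[OF y that _ that] by simp
  qed
  then show ?thesis using that y by blast
qed

section \<open>Integral operators with a Harnack kernel\<close>

lemma continuous_section_superposition:
  fixes f :: "real \<Rightarrow> real \<Rightarrow> real"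
  assumes "continuous_on (S \<times> {l..R}) (\<lambda>(t, x). f t x)" "continuous_on S x" "\<forall>t\<in>S. x t \<in> {l..R}"
  shows "continuous_on S (\<lambda>t. f t (x t))"
proof -
  have "continuous_on S (\<lambda>t. (\<lambda>(t, x). f t x) (t, x t))"
    by (rule continuous_on_compose2[OF assms(1)]) (use assms in \<open>auto intro!: continuous_intros\<close>)
  then show ?thesis by simp
qed

lemma kernel_section_continuous:
  fixes G :: "real \<Rightarrow> real \<Rightarrow> real"
  assumes "continuous_on ({0..T} \<times> {0..T}) (\<lambda>(t, \<tau>). G t \<tau>)" "t \<in> {0..T}"
  shows "continuous_on {0..T} (G t)"
proof -
  have "continuous_on {0..T} (\<lambda>\<tau>. (\<lambda>(t, \<tau>). G t \<tau>) (t, \<tau>))"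
    by (rule continuous_on_compose2[OF assms(1)]) (use assms in \<open>auto intro!: continuous_intros\<close>)
  then show ?thesis by simp
qed

text \<open>Uniform continuity of \<open>f\<close> on the compact strip controls the dependence on the function, and that
  of the kernel on the square controls the dependence on the point.\<close>

lemma hammerstein_operator_compact:
  fixes G f :: "real \<Rightarrow> real \<Rightarrow> real"
  assumes "T > 0"
    and G: "continuous_on ({0..T} \<times> {0..T}) (\<lambda>(t, \<tau>). G t \<tau>)"
    and f: "continuous_on ({0..T} \<times> {l..R}) (\<lambda>(t, x). f t x)"
    and D: "\<And>x. x \<in> D \<Longrightarrow> continuous_on {0..T} x \<and> (\<forall>t\<in>{0..T}. x t \<in> {l..R})"
  defines "A \<equiv> \<lambda>x. green_integral T G (\<lambda>\<tau>. f \<tau> (x \<tau>))"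
  shows "uniformly_continuous_operator {0..T} D A" "equicontinuous_image {0..T} D A"
proof -
  have fx: "continuous_on {0..T} (\<lambda>\<tau>. f \<tau> (x \<tau>))" if "x \<in> D" for x
    using continuous_section_superposition[OF f] D[OF that] by blast
  have int: "(\<lambda>\<tau>. G t \<tau> * f \<tau> (x \<tau>)) integrable_on {0..T}" if "x \<in> D" "t \<in> {0..T}" for x t
    by (intro integrable_continuous_interval continuous_on_mult fx that kernel_section_continuous[OF G])
  have "bounded ((\<lambda>(t, \<tau>). G t \<tau>) ` ({0..T} \<times> {0..T}))"
    by (intro compact_imp_bounded compact_continuous_image G compact_Times) auto
  then obtain Q where "Q > 0" and Q: "\<And>t \<tau>. \<lbrakk>t \<in> {0..T}; \<tau> \<in> {0..T}\<rbrakk> \<Longrightarrow> \<bar>G t \<tau>\<bar> \<le> Q"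
    unfolding bounded_pos by force
  have "bounded ((\<lambda>(t, x). f t x) ` ({0..T} \<times> {l..R}))"
    by (intro compact_imp_bounded compact_continuous_image f compact_Times) auto
  then obtain H where "H > 0" and H: "\<And>t x. \<lbrakk>t \<in> {0..T}; x \<in> {l..R}\<rbrakk> \<Longrightarrow> \<bar>f t x\<bar> \<le> H"
    unfolding bounded_pos by force
  show "uniformly_continuous_operator {0..T} D A"
    unfolding uniformly_continuous_operator_def
  proof (intro allI impI)
    fix e :: real assume "e > 0"
    define e' where "e' = e / (Q * T)"
    have "e' > 0" using \<open>e > 0\<close> \<open>Q > 0\<close> \<open>T > 0\<close> by (simp add: e'_def)
    have "uniformly_continuous_on ({0..T} \<times> {l..R}) (\<lambda>(t, x). f t x)"
      by (intro compact_uniformly_continuous f compact_Times) auto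
    then obtain d where "d > 0" and d: "\<And>p q. \<lbrakk>p \<in> {0..T} \<times> {l..R}; q \<in> {0..T} \<times> {l..R}; dist q p < d\<rbrakk>
        \<Longrightarrow> dist ((\<lambda>(t, x). f t x) q) ((\<lambda>(t, x). f t x) p) < e'"
      using \<open>e' > 0\<close> unfolding uniformly_continuous_on_def by blast
    have "\<bar>A x t - A y t\<bar> \<le> e"
      if "x \<in> D" "y \<in> D" and xy: "\<forall>t\<in>{0..T}. \<bar>x t - y t\<bar> \<le> d / 2" and "t \<in> {0..T}" for x y t
    proof -
      have fd: "\<bar>f \<tau> (x \<tau>) - f \<tau> (y \<tau>)\<bar> \<le> e'" if "\<tau> \<in> {0..T}" for \<tau>
      proof -
        have "\<bar>x \<tau> - y \<tau>\<bar> < d" using xy that \<open>d > 0\<close> by fastforce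
        then show ?thesis
          using d[of "(\<tau>, y \<tau>)" "(\<tau>, x \<tau>)"] D[OF \<open>x \<in> D\<close>] D[OF \<open>y \<in> D\<close>] that
          by (simp add: dist_Pair_Pair dist_real_def)
      qed
      have "A x t - A y t = integral {0..T} (\<lambda>\<tau>. G t \<tau> * f \<tau> (x \<tau>) - G t \<tau> * f \<tau> (y \<tau>))"
        unfolding A_def green_integral_def by (rule integral_diff[symmetric]) (intro int that)+
      also have "norm \<dots> \<le> Q * e' * (T - 0)"
      proof (rule integral_bound)
        show "continuous_on {0..T} (\<lambda>\<tau>. G t \<tau> * f \<tau> (x \<tau>) - G t \<tau> * f \<tau> (y \<tau>))"
          by (intro continuous_intros fx that kernel_section_continuous[OF G])
        show "norm (G t \<tau> * f \<tau> (x \<tau>) - G t \<tau> * f \<tau> (y \<tau>)) \<le> Q * e'" if "\<tau> \<in> {0..T}" for \<tau>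
          using mult_mono[OF Q[OF \<open>t \<in> {0..T}\<close> that] fd[OF that]] \<open>Q > 0\<close>
          by (simp add: abs_mult flip: right_diff_distrib)
      qed (use \<open>T > 0\<close> in simp)
      finally show ?thesis using \<open>Q > 0\<close> \<open>T > 0\<close> by (simp add: e'_def)
    qed
    then show "\<exists>d>0. \<forall>x\<in>D. \<forall>y\<in>D. (\<forall>t\<in>{0..T}. \<bar>x t - y t\<bar> \<le> d) \<longrightarrow> (\<forall>t\<in>{0..T}. \<bar>A x t - A y t\<bar> \<le> e)"
      using half_gt_zero[OF \<open>d > 0\<close>] by blast
  qed
  show "equicontinuous_image {0..T} D A"
    unfolding equicontinuous_image_def
  proof (intro allI impI)
    fix e :: real assume "e > 0"
    define e' where "e' = e / (2 * H * T)"
    have "e' > 0" using \<open>e > 0\<close> \<open>H > 0\<close> \<open>T > 0\<close> by (simp add: e'_def)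
    have "uniformly_continuous_on ({0..T} \<times> {0..T}) (\<lambda>(t, \<tau>). G t \<tau>)"
      by (intro compact_uniformly_continuous G compact_Times) auto
    then obtain d where "d > 0" and d: "\<And>p q. \<lbrakk>p \<in> {0..T} \<times> {0..T}; q \<in> {0..T} \<times> {0..T}; dist q p < d\<rbrakk>
        \<Longrightarrow> dist ((\<lambda>(t, \<tau>). G t \<tau>) q) ((\<lambda>(t, \<tau>). G t \<tau>) p) < e'"
      using \<open>e' > 0\<close> unfolding uniformly_continuous_on_def by blast
    have "\<bar>A x s - A x t\<bar> < e"
      if "x \<in> D" "s \<in> {0..T}" "t \<in> {0..T}" "dist s t < d" for x s t
    proof -
      have Gd: "\<bar>G s \<tau> - G t \<tau>\<bar> \<le> e'" if "\<tau> \<in> {0..T}" for \<tau>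
        using d[of "(t, \<tau>)" "(s, \<tau>)"] \<open>s \<in> {0..T}\<close> \<open>t \<in> {0..T}\<close> \<open>dist s t < d\<close> that
        by (simp add: dist_Pair_Pair dist_real_def)
      have "A x s - A x t = integral {0..T} (\<lambda>\<tau>. G s \<tau> * f \<tau> (x \<tau>) - G t \<tau> * f \<tau> (x \<tau>))"
        unfolding A_def green_integral_def by (rule integral_diff[symmetric]) (intro int that)+
      also have "norm \<dots> \<le> e' * H * (T - 0)"
      proof (rule integral_bound)
        show "continuous_on {0..T} (\<lambda>\<tau>. G s \<tau> * f \<tau> (x \<tau>) - G t \<tau> * f \<tau> (x \<tau>))"
          by (intro continuous_intros fx that kernel_section_continuous[OF G])
        show "norm (G s \<tau> * f \<tau> (x \<tau>) - G t \<tau> * f \<tau> (x \<tau>)) \<le> e' * H" if "\<tau> \<in> {0..T}" for \<tau>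
          using mult_mono[OF Gd[OF that] H[OF that, of "x \<tau>"]] D[OF \<open>x \<in> D\<close>] that \<open>e' > 0\<close>
          by (simp add: abs_mult flip: left_diff_distrib)
      qed (use \<open>T > 0\<close> in simp)
      also have "\<dots> < e" using \<open>H > 0\<close> \<open>T > 0\<close> \<open>e > 0\<close> by (simp add: e'_def)
      finally show ?thesis by simp
    qed
    then show "\<exists>d>0. \<forall>x\<in>D. \<forall>s\<in>{0..T}. \<forall>t\<in>{0..T}. dist s t < d \<longrightarrow> \<bar>A x s - A x t\<bar> < e"
      using \<open>d > 0\<close> by blast
  qed
qed

lemma green_integral_mono:
  assumes G: "continuous_on ({0..T} \<times> {0..T}) (\<lambda>(t, \<tau>). G t \<tau>)" and t: "t \<in> {0..T}"
    and h: "continuous_on {0..T} h" "continuous_on {0..T} k"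
    and "\<And>\<tau>. \<tau> \<in> {0..T} \<Longrightarrow> 0 \<le> G t \<tau>"
    and "\<And>\<tau>. \<tau> \<in> {0..T} \<Longrightarrow> h \<tau> \<le> k \<tau>"
  shows "green_integral T G h t \<le> green_integral T G k t"
  unfolding green_integral_def
  by (intro integral_le integrable_continuous_interval continuous_on_mult h
      kernel_section_continuous[OF G t] mult_left_mono assms)

text \<open>The diagonal value is a common bound: $c\,G(s,\tau) \le G(\tau,\tau) \le G(t,\tau)$ for all
  \<open>s\<close> and \<open>t\<close>, and this survives integration against a nonnegative function.\<close>

lemma green_integral_harnack:
  assumes G: "continuous_on ({0..T} \<times> {0..T}) (\<lambda>(t, \<tau>). G t \<tau>)" and "c \<le> 1"
    and bounds: "\<forall>t\<in>{0..T}. \<forall>\<tau>\<in>{0..T}. G t \<tau> \<ge> G \<tau> \<tau> \<and> G \<tau> \<tau> \<ge> c * G t \<tau>"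
    and nonneg: "\<forall>t\<in>{0..T}. \<forall>\<tau>\<in>{0..T}. 0 \<le> G t \<tau>"
    and h: "continuous_on {0..T} h" "\<And>\<tau>. \<tau> \<in> {0..T} \<Longrightarrow> 0 \<le> h \<tau>"
    and cont: "continuous_on {0..T} (green_integral T G h)"
  shows "green_integral T G h \<in> harnack_cone {0..T} c"
proof -
  have i: "(\<lambda>\<tau>. G t \<tau> * h \<tau>) integrable_on {0..T}" if "t \<in> {0..T}" for t
    by (intro integrable_continuous_interval continuous_on_mult h that kernel_section_continuous[OF G])
  have "c * green_integral T G h s \<le> green_integral T G h t" if "s \<in> {0..T}" "t \<in> {0..T}" for s t
  proof -
    have "c * green_integral T G h s = integral {0..T} (\<lambda>\<tau>. c * (G s \<tau> * h \<tau>))"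
      by (simp add: green_integral_def)
    also have "\<dots> \<le> integral {0..T} (\<lambda>\<tau>. G t \<tau> * h \<tau>)"
    proof (rule integral_le)
      show "(\<lambda>\<tau>. c * (G s \<tau> * h \<tau>)) integrable_on {0..T}"
        using i[OF \<open>s \<in> {0..T}\<close>] by (rule integrable_on_mult_right)
      fix \<tau> assume "\<tau> \<in> {0..T}"
      then have "c * G s \<tau> \<le> G t \<tau>" using bounds that by (meson order_trans)
      then show "c * (G s \<tau> * h \<tau>) \<le> G t \<tau> * h \<tau>"
        using mult_right_mono[OF _ h(2)[OF \<open>\<tau> \<in> {0..T}\<close>]] by (simp flip: mult.assoc)
    qed (rule i[OF \<open>t \<in> {0..T}\<close>])
    finally show ?thesis by (simp add: green_integral_def)
  qed
  moreover have "0 \<le> green_integral T G h t" if "t \<in> {0..T}" for t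
    unfolding green_integral_def by (rule integral_nonneg[OF i[OF that]]) (use nonneg h that in simp)
  ultimately show ?thesis using cont by (simp add: harnack_cone_def)
qed

section \<open>The periodic problem\<close>

lemma linear_periodic_solution_continuous:
  assumes "linear_periodic_solution T a m h x"
  shows "continuous_on {0..T} x"
proof -
  obtain x' where "\<forall>t\<in>{0..T}. (x has_real_derivative x' t) (at t within {0..T})"
    using assms by (auto simp: linear_periodic_solution_def periodic_twice_differentiable_def)
  then show ?thesis by (intro DERIV_continuous_on) blast
qed

text \<open>For arbitrary exponents the powers are continuous only away from 0, whence \<open>l > 0\<close>.\<close>

lemma f_shift_continuous:
  assumes "continuous_on {0..T} r" "continuous_on {0..T} s" "l > 0"
  shows "continuous_on ({0..T} \<times> {l..R}) (\<lambda>(t, x). f_shift r s \<alpha> \<beta> m t x)"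
proof -
  have "continuous_on ({0..T} \<times> {l..R}) (\<lambda>p. r (fst p))"
    by (rule continuous_on_compose2[OF assms(1)]) (auto intro!: continuous_intros)
  moreover have "continuous_on ({0..T} \<times> {l..R}) (\<lambda>p. s (fst p))"
    by (rule continuous_on_compose2[OF assms(2)]) (auto intro!: continuous_intros)
  ultimately show ?thesis
    unfolding f_shift_def case_prod_beta
    by (intro continuous_intros) (use \<open>l > 0\<close> in auto)
qed

theorem theorem8:
  fixes T a \<alpha> \<beta> m c R\<^sub>1 R\<^sub>2 :: real
    and r s g\<^sub>0 g\<^sub>1 :: "real \<Rightarrow> real"
    and G :: "real \<Rightarrow> real \<Rightarrow> real"
  assumes "T > 0" and "a \<ge> 0"
    and "continuous_on {0..T} r" and "continuous_on {0..T} s"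
    and "0 < \<alpha>" and "\<alpha> < \<beta>" and "\<beta> < 1"
    and "m > 0" and "R\<^sub>2 > 0" and "0 < R\<^sub>1" and "R\<^sub>1 < R\<^sub>2"
    and "m\<^sup>2 < (pi / T)\<^sup>2 + (a / 2)\<^sup>2"
    and "is_periodic_green T a m G"
    and "0 < c" and "c < 1"
    and "\<forall>t\<in>{0..T}. \<forall>\<tau>\<in>{0..T}. G t \<tau> \<ge> G \<tau> \<tau> \<and> G \<tau> \<tau> \<ge> c * G t \<tau>"
    and "\<forall>t\<in>{0..T}. \<forall>x\<in>{c * R\<^sub>1..R\<^sub>2}. f_shift r s \<alpha> \<beta> m t x \<ge> 0"
    and "continuous_on {0..T} g\<^sub>1"
    and "\<forall>t\<in>{0..T}. \<forall>x\<in>{c * R\<^sub>2..R\<^sub>2}. f_shift r s \<alpha> \<beta> m t x \<le> g\<^sub>1 t"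
    and "(INF t\<in>{0..T}. green_integral T G g\<^sub>1 t) \<le> c * R\<^sub>2 \<or>
         (SUP t\<in>{0..T}. green_integral T G g\<^sub>1 t) \<le> R\<^sub>2"
    and "continuous_on {0..T} g\<^sub>0"
    and "\<forall>t\<in>{0..T}. \<forall>x\<in>{c * R\<^sub>1..R\<^sub>1}. f_shift r s \<alpha> \<beta> m t x \<ge> g\<^sub>0 t \<and> g\<^sub>0 t \<ge> 0"
    and "(INF t\<in>{0..T}. green_integral T G g\<^sub>0 t) \<ge> c * R\<^sub>1 \<or>
         (SUP t\<in>{0..T}. green_integral T G g\<^sub>0 t) \<ge> R\<^sub>1"
  shows "\<exists>x x' x''. periodic_twice_differentiable T x x' x'' \<and>
           (\<forall>t\<in>{0..T}. x'' t + a * x' t = r t * x t powr \<alpha> - s t * x t powr \<beta>) \<and>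
           (\<forall>t\<in>{0..T}. c * R\<^sub>1 \<le> x t \<and> x t \<le> R\<^sub>2)"
proof -
  note f_nonneg = assms(17) and f_le = assms(19) and delta = assms(20)
    and f_ge = assms(22) and gamma = assms(23) and bounds = assms(16)
  let ?S = "{0..T}" and ?f = "f_shift r s \<alpha> \<beta> m" and ?K = "cone_section {0..T} c (c * R\<^sub>1) R\<^sub>2"
  define A where "A x = green_integral T G (\<lambda>\<tau>. ?f \<tau> (x \<tau>))" for x
  have S: "compact ?S" "?S \<noteq> {}" using \<open>T > 0\<close> by auto
  have c: "0 \<le> c" "c \<le> 1" using \<open>0 < c\<close> \<open>c < 1\<close> by auto
  have G: "continuous_on (?S \<times> ?S) (\<lambda>(t, \<tau>). G t \<tau>)"
    and solves: "\<And>h. continuous_on ?S h \<Longrightarrow> linear_periodic_solution T a m h (green_integral T G h)"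
    using \<open>is_periodic_green T a m G\<close> unfolding is_periodic_green_def by blast+
  \<comment> \<open>On the diagonal the two-sided bound reads \<open>G \<tau> \<tau> \<ge> c * G \<tau> \<tau>\<close>; with \<open>c < 1\<close> this gives the sign.\<close>
  have G0: "0 \<le> G t \<tau>" if "t \<in> ?S" "\<tau> \<in> ?S" for t \<tau>
  proof -
    have "c * G \<tau> \<tau> \<le> G \<tau> \<tau>" using bounds that by blast
    then have "(1 - c) * G \<tau> \<tau> \<ge> 0" by (simp add: algebra_simps)
    then have "0 \<le> G \<tau> \<tau>" using \<open>c < 1\<close> by (simp add: zero_le_mult_iff)
    also have "\<dots> \<le> G t \<tau>" using bounds that by blast
    finally show ?thesis .
  qed
  have green_cont: "continuous_on ?S (green_integral T G h)" if "continuous_on ?S h" for h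
    using solves[OF that] by (rule linear_periodic_solution_continuous)
  have mono: "green_integral T G h t \<le> green_integral T G k t"
    if "continuous_on ?S h" "continuous_on ?S k" "\<And>\<tau>. \<tau> \<in> ?S \<Longrightarrow> h \<tau> \<le> k \<tau>" "t \<in> ?S" for h k t
    using green_integral_mono[OF G that(4) that(1,2)] G0 that by blast
  have f: "continuous_on (?S \<times> {c * R\<^sub>1..R\<^sub>2}) (\<lambda>(t, x). ?f t x)"
    using assms by (intro f_shift_continuous) auto
  have KD: "continuous_on ?S x \<and> (\<forall>t\<in>?S. x t \<in> {c * R\<^sub>1..R\<^sub>2})" if "x \<in> ?K" for x
    using that by (auto simp: cone_section_def harnack_cone_def)
  have harnack: "c * x t \<le> x s" if "x \<in> harnack_cone ?S c" "s \<in> ?S" "t \<in> ?S" for x s t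
    using that by (auto simp: harnack_cone_def)
  have K_cone: "x \<in> harnack_cone ?S c" if "x \<in> ?K" for x
    using that by (simp add: cone_section_def)
  have cone_cont: "continuous_on ?S x" if "x \<in> harnack_cone ?S c" for x
    using that by (simp add: harnack_cone_def)
  have fx: "continuous_on ?S (\<lambda>\<tau>. ?f \<tau> (x \<tau>))" if "x \<in> ?K" for x
    using continuous_section_superposition[OF f] KD[OF that] by blast
  have into: "A x \<in> harnack_cone ?S c" if "x \<in> ?K" for x
    unfolding A_def
  proof (rule green_integral_harnack[OF G c(2) bounds _ fx[OF that] _ green_cont[OF fx[OF that]]])
    show "0 \<le> ?f \<tau> (x \<tau>)" if "\<tau> \<in> ?S" for \<tau>
      using f_nonneg KD[OF \<open>x \<in> ?K\<close>] that by blast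
  qed (use G0 in blast)
  have compact: "uniformly_continuous_operator ?S ?K A" "equicontinuous_image ?S ?K A"
    unfolding A_def using hammerstein_operator_compact[OF \<open>T > 0\<close> G f KD] by blast+
  have outer: "A x t \<le> R\<^sub>2" if x: "x \<in> ?K" and p: "p \<in> ?S" "x p = R\<^sub>2" and t: "t \<in> ?S" for x p t
  proof -
    have "?f \<tau> (x \<tau>) \<le> g\<^sub>1 \<tau>" if "\<tau> \<in> ?S" for \<tau>
      using f_le harnack[OF K_cone[OF x] that p(1)] KD[OF x] p(2) that by simp
    then have le: "A x q \<le> green_integral T G g\<^sub>1 q" if "q \<in> ?S" for q
      unfolding A_def by (intro mono fx x that) (use assms in auto)
    note \<delta>_cont = green_cont[OF \<open>continuous_on ?S g\<^sub>1\<close>]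
    from delta show ?thesis
    proof
      assume inf: "(INF t\<in>?S. green_integral T G g\<^sub>1 t) \<le> c * R\<^sub>2"
      obtain q where "q \<in> ?S" "(INF t\<in>?S. green_integral T G g\<^sub>1 t) = green_integral T G g\<^sub>1 q"
        using INF_attained[OF S \<delta>_cont] by blast
      then have "c * A x t \<le> c * R\<^sub>2"
        using inf le[of q] harnack[OF into[OF x], of q t] t by linarith
      then show ?thesis using \<open>0 < c\<close> by simp
    next
      assume sup: "(SUP t\<in>?S. green_integral T G g\<^sub>1 t) \<le> R\<^sub>2"
      obtain q where "(SUP t\<in>?S. green_integral T G g\<^sub>1 t) = green_integral T G g\<^sub>1 q"
        "\<forall>t\<in>?S. green_integral T G g\<^sub>1 t \<le> green_integral T G g\<^sub>1 q"
        using SUP_attained[OF S \<delta>_cont] by blast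
      then show ?thesis using sup le[OF t] t by fastforce
    qed
  qed
  have ge: "A x t \<ge> green_integral T G g\<^sub>0 t"
    if x: "x \<in> ?K" and "\<forall>t\<in>?S. x t \<le> R\<^sub>1" and t: "t \<in> ?S" for x t
    unfolding A_def using f_ge KD[OF x] that
    by (intro mono fx x t \<open>continuous_on ?S g\<^sub>0\<close>) simp
  note \<gamma>_cont = green_cont[OF \<open>continuous_on ?S g\<^sub>0\<close>]
  obtain x where x: "x \<in> ?K" and fixed: "\<forall>t\<in>?S. A x t = x t"
    using gamma
  proof
    \<comment> \<open>The inner boundary is \<open>min y = c * R\<^sub>1\<close>; the cone keeps its points below \<open>R\<^sub>1\<close>.\<close>
    assume inf: "(INF t\<in>?S. green_integral T G g\<^sub>0 t) \<ge> c * R\<^sub>1"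
    have le_R1: "y t \<le> R\<^sub>1" if y: "y \<in> harnack_cone ?S c" "(INF t\<in>?S. y t) \<le> c * R\<^sub>1" "t \<in> ?S" for y t
    proof -
      obtain p where "p \<in> ?S" "(INF t\<in>?S. y t) = y p"
        using INF_attained[OF S cone_cont[OF y(1)]] by blast
      then have "c * y t \<le> c * R\<^sub>1" using harnack[OF y(1), of p t] y by linarith
      then show ?thesis using \<open>0 < c\<close> by simp
    qed
    show ?thesis
    proof (rule cone_compression[where S = ?S and M = "\<lambda>x. INF t\<in>?S. x t" and L = "c * R\<^sub>1"
          and l = "c * R\<^sub>1" and c = c and R = R\<^sub>2 and A = A, OF S c \<open>R\<^sub>2 > 0\<close>])
      show "c * R\<^sub>1 \<le> y t" if "y \<in> harnack_cone ?S c" "(INF t\<in>?S. y t) \<ge> c * R\<^sub>1" "t \<in> ?S" for y t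
        using INF_attained[OF S cone_cont[OF that(1)]] that by (metis order_trans)
      show "y t < R\<^sub>2" if "y \<in> harnack_cone ?S c" "(INF t\<in>?S. y t) \<le> c * R\<^sub>1" "t \<in> ?S" for y t
        using le_R1[OF that] \<open>R\<^sub>1 < R\<^sub>2\<close> by simp
      show "(INF t\<in>?S. A y t) \<ge> c * R\<^sub>1" if y: "y \<in> ?K" "(INF t\<in>?S. y t) = c * R\<^sub>1" for y
      proof (rule cINF_greatest[OF S(2)])
        fix t assume t: "t \<in> ?S"
        have "c * R\<^sub>1 \<le> green_integral T G g\<^sub>0 t"
          using INF_attained[OF S \<gamma>_cont] inf t by (metis order_trans)
        also have "\<dots> \<le> A y t" using le_R1[OF K_cone] y t by (intro ge) auto
        finally show "c * R\<^sub>1 \<le> A y t" .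
      qed
    qed (use into compact outer that INF_nonexpansive[OF S] INF_translate[OF S] in auto)
  next
    \<comment> \<open>The inner boundary is \<open>max y = R\<^sub>1\<close>; the cone keeps its points above \<open>c * R\<^sub>1\<close>.\<close>
    assume sup: "(SUP t\<in>?S. green_integral T G g\<^sub>0 t) \<ge> R\<^sub>1"
    have le_R1: "y t \<le> R\<^sub>1" if "y \<in> harnack_cone ?S c" "(SUP t\<in>?S. y t) \<le> R\<^sub>1" "t \<in> ?S" for y t
      using SUP_attained[OF S cone_cont[OF that(1)]] that by (metis order_trans)
    show ?thesis
    proof (rule cone_compression[where S = ?S and M = "\<lambda>x. SUP t\<in>?S. x t" and L = R\<^sub>1
          and l = "c * R\<^sub>1" and c = c and R = R\<^sub>2 and A = A, OF S c \<open>R\<^sub>2 > 0\<close>])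
      show "c * R\<^sub>1 \<le> y t" if y: "y \<in> harnack_cone ?S c" "(SUP t\<in>?S. y t) \<ge> R\<^sub>1" "t \<in> ?S" for y t
      proof -
        obtain p where p: "p \<in> ?S" "(SUP t\<in>?S. y t) = y p"
          using SUP_attained[OF S cone_cont[OF y(1)]] by blast
        have "c * R\<^sub>1 \<le> c * y p" using p y c by (intro mult_left_mono) auto
        also have "\<dots> \<le> y t" using harnack y p by blast
        finally show ?thesis .
      qed
      show "y t < R\<^sub>2" if "y \<in> harnack_cone ?S c" "(SUP t\<in>?S. y t) \<le> R\<^sub>1" "t \<in> ?S" for y t
        using le_R1[OF that] \<open>R\<^sub>1 < R\<^sub>2\<close> by simp
      show "(SUP t\<in>?S. A y t) \<ge> R\<^sub>1" if y: "y \<in> ?K" "(SUP t\<in>?S. y t) = R\<^sub>1" for y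
      proof -
        obtain q where q: "q \<in> ?S" "(SUP t\<in>?S. green_integral T G g\<^sub>0 t) = green_integral T G g\<^sub>0 q"
          using SUP_attained[OF S \<gamma>_cont] by blast
        obtain p where "(SUP t\<in>?S. A y t) = A y p" "\<forall>t\<in>?S. A y t \<le> A y p"
          using SUP_attained[OF S cone_cont[OF into[OF y(1)]]] by blast
        moreover have "green_integral T G g\<^sub>0 q \<le> A y q"
          using le_R1[OF K_cone] y q by (intro ge) auto
        ultimately show ?thesis using q sup by fastforce
      qed
    qed (use into compact outer that SUP_nonexpansive[OF S] SUP_translate[OF S] in auto)
  qed
  obtain u' u'' where u: "periodic_twice_differentiable T (A x) u' u''"
    and eqn: "\<forall>t\<in>?S. u'' t + a * u' t + m\<^sup>2 * A x t = ?f t (x t)"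
    using solves[OF fx[OF x]] unfolding linear_periodic_solution_def A_def by blast
  have "u'' t + a * u' t = r t * A x t powr \<alpha> - s t * A x t powr \<beta>" if "t \<in> ?S" for t
    using eqn fixed that by (simp add: f_shift_def)
  moreover have "c * R\<^sub>1 \<le> A x t \<and> A x t \<le> R\<^sub>2" if "t \<in> ?S" for t
    using KD[OF x] fixed that by simp
  ultimately show ?thesis using u by blast
qed

end
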